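(* Let $v$ be a positive integer or $v=\infty$, let $m,n$ be positive integers, let $\mathbf h=(\eta_1,\ldots,\eta_m)$ and $\mathbf k=(\kappa_1,\ldots,\kappa_n)$ be sequences of integers with $1\le\eta_i\le n$ and $1\le\kappa_j\le m$ for all $i,j$, and let $S\subseteq[1,\lfloor\frac{v-1}{2}\rfloor]$ (regarded as a subset of $\mathbb Z_v$; for $v=\infty$ this means $S\subseteq\mathbb N$) be such that $$|S|=\eta_1+\cdots+\eta_m=\kappa_1+\cdots+\kappa_n.$$ There exists a nonzero sum and simple NGHA$_S(m,n;\mathbf h,\mathbf k)$ over $\mathbb Z_v$ whenever either 1. $\mathbf h$ and $\mathbf k$ are constant sequences, or 2. $m$ and $n$ are even, $\mathbf h=2\cdot(h_1,h_1,\ldots,h_{m/2},h_{m/2})$ and $\mathbf k=2\cdot(k_1,k_1,\ldots,k_{n/2},k_{n/2})$ for some positive integers $h_1,\dots,h_{m/2},k_1,\dots,k_{n/2}$, and $\sum_{i=1}^m\min(\eta_i,u)\ge\sum_{j=1}^u\kappa'_j$ for every $1\le u\le n$, where $(\kappa'_1,\ldots,\kappa'_n)$ is the decreasing (nonincreasing) reordering of $\mathbf k$.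
   Context: $\mathbb N=\{1,2,\dots\}$; $\mathbb Z_v$ is the ring of integers modulo $v$, and $\mathbb Z_\infty=\mathbb Z$. The absolute value of $a\in\mathbb Z_v$ is $\|a\|=\|-a\|\in\{a,-a\}$, chosen so that the nonzero absolute values form $\mathbb Z_v^+=\{1,\ldots,\lfloor v/2\rfloor\}$ ($\mathbb Z_\infty^+=\mathbb N$). For $S\subseteq\mathbb Z_v^+$ containing no element of order $2$, a GHA$_S(m,n;\mathbf h,\mathbf k)$ over $\mathbb Z_v$ (multiplicity $\lambda=1$) is an $m\times n$ matrix $H$ over $\mathbb Z_v$ such that the multiset of absolute values of the nonzero entries of $H$ equals the set $S$ (each element occurring exactly once), and the $i$-th row (resp. $j$-th column) of $H$ contains exactly $\eta_i$ (resp. $\kappa_j$) nonzero entries, where $\mathbf h=(\eta_1,\dots,\eta_m)$, $\mathbf k=(\kappa_1,\dots,\kappa_n)$. A natural ordering of a row (resp. column) is a sequence obtained by cyclically sequencing from left to right (resp. top to bottom) its nonzero entries starting from a given one. An NGHA is a GHA endowed with a natural ordering of every row and every column. It is nonzero sum if the sum of each row and each column is nonzero. A sequence $(a_1,\ldots,a_t)$ is simple if its partial sums $a_1,a_1+a_2,\ldots,a_1+\cdots+a_t$ are pairwise distinct and nonzero, except possibly that the total sum may be zero. The NGHA is simple if the given (natural) orderings of all rows and all columns are simple sequences. *)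

theory Defs
  imports
    "HOL-Number_Theory.Residues"
    "HOL-Algebra.IntRing"
    "HOL-Library.Extended_Nat"
    "HOL-Library.Multiset"
    "Jordan_Normal_Form.Matrix"
begin

text \<open>
  The parameter \<open>v\<close> is a positive integer or \<open>\<infinity>\<close>. For finite \<open>v\<close> the elements of the ring of
  integers modulo \<open>v\<close> are represented by their canonical residues \<open>0, \<dots>, v - 1\<close>.
\<close>

definition Zmod :: "enat \<Rightarrow> int ring" where
  "Zmod v = (case v of enat q \<Rightarrow> residue_ring (int q) | \<infinity> \<Rightarrow> \<Z>)"

definition Zmod_pos :: "enat \<Rightarrow> int set" where
  "Zmod_pos v = (case v of enat q \<Rightarrow> {1..int q div 2} | \<infinity> \<Rightarrow> {1..})"

text \<open>The interval from 1 to \<open>\<lfloor>(v - 1) / 2\<rfloor>\<close>, and all positive integers for \<open>v = \<infinity>\<close>.\<close>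

definition Zmod_half :: "enat \<Rightarrow> int set" where
  "Zmod_half v = (case v of enat q \<Rightarrow> {1..(int q - 1) div 2} | \<infinity> \<Rightarrow> {1..})"

definition Zmod_abs :: "enat \<Rightarrow> int \<Rightarrow> int" where
  "Zmod_abs v a = (if a \<in> Zmod_pos v then a else \<ominus>\<^bsub>Zmod v\<^esub> a)"

text \<open>
  Matrices, and the sequences \<open>h\<close> and \<open>k\<close> of row and column weights, are indexed from 0.
  The next two lists consist of the nonzero entries of a row from left to right, and of a column
  from top to bottom.
\<close>

definition row_entries :: "enat \<Rightarrow> int mat \<Rightarrow> nat \<Rightarrow> int list" where
  "row_entries v H i = filter (\<lambda>x. x \<noteq> \<zero>\<^bsub>Zmod v\<^esub>) (list_of_vec (row H i))"

definition col_entries :: "enat \<Rightarrow> int mat \<Rightarrow> nat \<Rightarrow> int list" where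
  "col_entries v H j = filter (\<lambda>x. x \<noteq> \<zero>\<^bsub>Zmod v\<^esub>) (list_of_vec (col H j))"

text \<open>
  The set \<open>S\<close> is required to be finite because \<open>mset_set\<close> is empty on infinite sets; this is no
  restriction, since \<open>S\<close> is the set of absolute values of the nonzero entries of a finite matrix.
  The condition \<open>s \<oplus> s \<noteq> \<zero>\<close> says that the nonzero element \<open>s\<close> does not have order 2.
\<close>

definition is_GHA ::
  "enat \<Rightarrow> int set \<Rightarrow> nat \<Rightarrow> nat \<Rightarrow> nat list \<Rightarrow> nat list \<Rightarrow> int mat \<Rightarrow> bool" where
  "is_GHA v S m n h k H \<longleftrightarrow>
     finite S \<and> S \<subseteq> Zmod_pos v \<and> (\<forall>s\<in>S. s \<oplus>\<^bsub>Zmod v\<^esub> s \<noteq> \<zero>\<^bsub>Zmod v\<^esub>) \<and>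
     length h = m \<and> length k = n \<and>
     H \<in> carrier_mat m n \<and>
     (\<forall>i<m. \<forall>j<n. H $$ (i, j) \<in> carrier (Zmod v)) \<and>
     image_mset (\<lambda>(i, j). Zmod_abs v (H $$ (i, j)))
       (mset_set {(i, j). i < m \<and> j < n \<and> H $$ (i, j) \<noteq> \<zero>\<^bsub>Zmod v\<^esub>}) = mset_set S \<and>
     (\<forall>i<m. length (row_entries v H i) = h ! i) \<and>
     (\<forall>j<n. length (col_entries v H j) = k ! j)"

definition natural_ordering :: "int list \<Rightarrow> int list \<Rightarrow> bool" where
  "natural_ordering xs ys \<longleftrightarrow> (\<exists>r. ys = rotate r xs)"

text \<open>
  An NGHA consists of a GHA \<open>H\<close>, an ordering \<open>\<rho> i\<close> of every row \<open>i\<close> and an ordering \<open>\<gamma> j\<close> of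
  every column \<open>j\<close>; the row and column orderings are chosen independently of each other.
\<close>

definition is_NGHA ::
  "enat \<Rightarrow> int set \<Rightarrow> nat \<Rightarrow> nat \<Rightarrow> nat list \<Rightarrow> nat list \<Rightarrow>
   int mat \<Rightarrow> (nat \<Rightarrow> int list) \<Rightarrow> (nat \<Rightarrow> int list) \<Rightarrow> bool" where
  "is_NGHA v S m n h k H \<rho> \<gamma> \<longleftrightarrow>
     is_GHA v S m n h k H \<and>
     (\<forall>i<m. natural_ordering (row_entries v H i) (\<rho> i)) \<and>
     (\<forall>j<n. natural_ordering (col_entries v H j) (\<gamma> j))"

definition nonzero_sum :: "enat \<Rightarrow> nat \<Rightarrow> nat \<Rightarrow> int mat \<Rightarrow> bool" where
  "nonzero_sum v m n H \<longleftrightarrow>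
     (\<forall>i<m. (\<Oplus>\<^bsub>Zmod v\<^esub>j\<in>{..<n}. H $$ (i, j)) \<noteq> \<zero>\<^bsub>Zmod v\<^esub>) \<and>
     (\<forall>j<n. (\<Oplus>\<^bsub>Zmod v\<^esub>i\<in>{..<m}. H $$ (i, j)) \<noteq> \<zero>\<^bsub>Zmod v\<^esub>)"

definition partial_sum :: "enat \<Rightarrow> int list \<Rightarrow> nat \<Rightarrow> int" where
  "partial_sum v xs t = (\<Oplus>\<^bsub>Zmod v\<^esub>l\<in>{..<t}. xs ! l)"

definition simple_seq :: "enat \<Rightarrow> int list \<Rightarrow> bool" where
  "simple_seq v xs \<longleftrightarrow>
     inj_on (partial_sum v xs) {1..length xs} \<and>
     (\<forall>t\<in>{1..<length xs}. partial_sum v xs t \<noteq> \<zero>\<^bsub>Zmod v\<^esub>)"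

definition simple_orderings ::
  "enat \<Rightarrow> nat \<Rightarrow> nat \<Rightarrow> (nat \<Rightarrow> int list) \<Rightarrow> (nat \<Rightarrow> int list) \<Rightarrow> bool" where
  "simple_orderings v m n \<rho> \<gamma> \<longleftrightarrow>
     (\<forall>i<m. simple_seq v (\<rho> i)) \<and> (\<forall>j<n. simple_seq v (\<gamma> j))"

definition constant_seq :: "nat list \<Rightarrow> bool" where
  "constant_seq xs \<longleftrightarrow> (\<exists>c. xs = replicate (length xs) c)"

text \<open>The sequences of the form \<open>2 \<cdot> (x\<^sub>1, x\<^sub>1, \<dots>, x\<^sub>r, x\<^sub>r)\<close> with positive \<open>x\<^sub>1, \<dots>, x\<^sub>r\<close>.\<close>

definition doubled_pairs :: "nat list \<Rightarrow> bool" where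
  "doubled_pairs ys \<longleftrightarrow>
     (\<exists>xs. (\<forall>x\<in>set xs. 0 < x) \<and> ys = map (\<lambda>x. 2 * x) (concat (map (\<lambda>x. [x, x]) xs)))"

definition nonincreasing_reordering :: "nat list \<Rightarrow> nat list" where
  "nonincreasing_reordering xs = rev (sort xs)"

end

(*
Fill the chosen cells with the elements of S in increasing order, row by row, so that absolute
values increase along every row and down every column.  If moreover the signs alternate along
every row and every column, the partial sums of a line are nonzero, those of even and of odd length
have opposite signs and each of the two families is strictly monotone, and all of them are less
than v/2 in absolute value.  Hence the orderings from left to right and from top to bottom already
work, and only a 0/1 pattern with an alternating choice of signs is needed.

For constant h = (c,...,c) and k = (d,...,d) put g = gcd(m,n) and e = cg/n.  The Toeplitz pattern of
all cells with (j - i) mod g < e has the right weights, and as sign of a cell one can take the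
parity of the number of supported diagonals below the diagonal j - i, counted from a fixed
diagonal.  In the second case the Gale-Ryser theorem gives an (m/2) x (n/2) pattern with
weights h_i and k_j, whose cells are blown up to 2 x 2 blocks with checkerboard signs.
*)

theory Submission imports Defs "HOL-Combinatorics.List_Permutation"
begin

section \<open>Residues modulo \<open>v\<close> and integers of absolute value below
  \<open>v\<close>/2\<close>

definition residue :: "enat \<Rightarrow> int \<Rightarrow> int" where
  "residue v x = (case v of enat q \<Rightarrow> x mod int q | \<infinity> \<Rightarrow> x)"

text \<open>On these integers \<open>residue v\<close> is injective, so distinctness and
  non-vanishing in the ring can be checked over the integers.\<close>

definition small :: "enat \<Rightarrow> int \<Rightarrow> bool" where
  "small v x \<longleftrightarrow> (case v of enat q \<Rightarrow> 2 * \<bar>x\<bar> < int q | \<infinity> \<Rightarrow> True)"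

lemma residue_0 [simp]: "residue v 0 = 0"
  by (simp add: residue_def split: enat.split)

lemma Zmod_zero [simp]: "1 < v \<Longrightarrow> \<zero>\<^bsub>Zmod v\<^esub> = 0"
  by (auto simp: Zmod_def residue_ring_def one_enat_def split: enat.splits)

lemma cring_Zmod: "1 < v \<Longrightarrow> cring (Zmod v)"
  by (auto simp: Zmod_def one_enat_def residues_def int_is_cring intro!: residues.cring
      split: enat.splits)

lemma residue_in_carrier: "1 < v \<Longrightarrow> residue v x \<in> carrier (Zmod v)"
  by (auto simp: Zmod_def residue_ring_def residue_def one_enat_def
      split: enat.splits)

lemma residue_add:
  "1 < v \<Longrightarrow> residue v x \<oplus>\<^bsub>Zmod v\<^esub> residue v y = residue v (x + y)"
  by (auto simp: Zmod_def residue_ring_def residue_def one_enat_def mod_simps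
      split: enat.splits)

lemma residue_uminus:
  assumes "1 < v"
  shows "\<ominus>\<^bsub>Zmod v\<^esub> residue v x = residue v (- x)"
proof -
  interpret cring "Zmod v" by (rule cring_Zmod[OF assms])
  show ?thesis
    by (rule minus_equality) (simp_all add: residue_add residue_in_carrier assms)
qed

lemma finsum_residue:
  assumes "1 < v" "finite A"
  shows "(\<Oplus>\<^bsub>Zmod v\<^esub>i\<in>A. residue v (f i)) = residue v (\<Sum>i\<in>A. f i)"
proof -
  interpret cring "Zmod v" by (rule cring_Zmod[OF assms(1)])
  show ?thesis using assms(2)
    by induction (simp_all add: residue_add residue_in_carrier assms)
qed

text \<open>For finite \<open>v\<close>, two small integers differ by less than \<open>v\<close>, so
  \<open>v\<close> divides their difference only if it is 0.\<close>

lemma residue_inj: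
  assumes "small v x" "small v y" "residue v x = residue v y"
  shows "x = y"
proof (cases v)
  case (enat q)
  have "int q dvd x - y" using assms(3) enat by (simp add: residue_def mod_eq_dvd_iff)
  moreover have "\<bar>x - y\<bar> < int q" using assms(1,2) enat by (auto simp: small_def)
  ultimately show ?thesis using dvd_imp_le_int[of "x - y" "int q"] by auto
qed (use assms in \<open>simp add: residue_def\<close>)

lemma small_0: "1 < v \<Longrightarrow> small v 0"
  by (auto simp: small_def one_enat_def split: enat.splits)

lemma residue_eq_0_iff: "1 < v \<Longrightarrow> small v x \<Longrightarrow> residue v x = 0 \<longleftrightarrow> x = 0"
  using residue_inj[of v x 0] small_0 by auto

lemma small_le: "small v y \<Longrightarrow> \<bar>x\<bar> \<le> \<bar>y\<bar> \<Longrightarrow> small v x"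
  by (auto simp: small_def split: enat.splits)

lemma Zmod_half_iff: "x \<in> Zmod_half v \<longleftrightarrow> 0 < x \<and> small v x"
  by (auto simp: small_def Zmod_half_def split: enat.splits)

lemma Zmod_half_subset: "Zmod_half v \<subseteq> Zmod_pos v"
  by (auto simp: Zmod_half_def Zmod_pos_def split: enat.splits)

text \<open>The residue of \<open>x\<close> is \<open>x\<close> itself. For finite \<open>v\<close>
  that of \<open>- x\<close> is \<open>v\<close> - \<open>x\<close>, which exceeds
  \<open>v\<close>/2 and so lies outside \<open>Zmod_pos v\<close>; hence \<open>Zmod_abs\<close>
  negates it.\<close>

lemma Zmod_abs_residue:
  assumes "1 < v" "0 < x" "small v x"
  shows "Zmod_abs v (residue v x) = x" "Zmod_abs v (residue v (- x)) = x"
proof -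
  have x: "residue v x = x"
    using assms by (auto simp: residue_def small_def split: enat.splits)
  have "x \<in> Zmod_pos v" using assms Zmod_half_iff Zmod_half_subset by blast
  then show "Zmod_abs v (residue v x) = x" by (simp add: x Zmod_abs_def)
  have "residue v (- x) \<notin> Zmod_pos v"
    using assms
    by (auto simp: residue_def small_def Zmod_pos_def zmod_zminus1_eq_if split: enat.splits)
  then show "Zmod_abs v (residue v (- x)) = x"
    using residue_uminus[OF assms(1), of "- x"] x by (simp add: Zmod_abs_def)
qed

section \<open>Lines with increasing absolute values and alternating signs\<close>

text \<open>The absolute values \<open>D t\<close> of the partial sums satisfy
  \<open>D (Suc t) = w (Suc t) - D t\<close>, which keeps them positive and at most
  \<open>w t\<close>. Sums whose lengths differ in parity have opposite signs; for lengths of equal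
  parity \<open>D\<close> is strictly increasing.\<close>

lemma alternating_partial_sums:
  fixes w :: "nat \<Rightarrow> int"
  assumes pos: "\<And>l. l < N \<Longrightarrow> 0 < w l"
    and mono: "\<And>l. Suc l < N \<Longrightarrow> w l < w (Suc l)"
  defines "T \<equiv> \<lambda>t. \<Sum>l<t. (-1) ^ l * w l"
  shows "\<And>t. t < N \<Longrightarrow> 0 < (-1) ^ t * T (Suc t) \<and> (-1) ^ t * T (Suc t) \<le> w t"
    and "inj_on T {1..N}"
proof -
  define D where "D t = (-1) ^ t * T (Suc t)" for t
  have D_Suc: "D (Suc t) = w (Suc t) - D t" for t
  proof -
    have "(-1) ^ Suc t * ((-1) ^ Suc t * w (Suc t)) = w (Suc t)"
      by (simp add: power_mult_distrib[symmetric] mult.assoc[symmetric])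
    then show ?thesis by (simp add: D_def T_def algebra_simps)
  qed
  have bound: "0 < D t \<and> D t \<le> w t" if "t < N" for t
    using that
  proof (induction t)
    case 0
    then show ?case using pos[of 0] by (simp add: D_def T_def)
  next
    case (Suc t)
    then show ?case using D_Suc[of t] mono[of t] by simp
  qed
  then show "\<And>t. t < N \<Longrightarrow> 0 < (-1) ^ t * T (Suc t) \<and> (-1) ^ t * T (Suc t) \<le> w t"
    by (simp add: D_def)
  \<comment> \<open>Applying \<open>D_Suc\<close> twice gives
    \<open>D (t + 2) - D t = w (t + 2) - w (t + 1)\<close>, which is positive.\<close>
  have step: "D t < D (t + 2 * Suc r)" if "t + 2 * Suc r < N" for t r
    using that
  proof (induction r)
    case 0
    then show ?case using D_Suc[of t] D_Suc[of "Suc t"] mono[of "Suc t"]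
      by (simp add: eval_nat_numeral)
  next
    case (Suc r)
    then show ?case
      using D_Suc[of "t + 2 * Suc r"] D_Suc[of "Suc (t + 2 * Suc r)"]
        mono[of "Suc (t + 2 * Suc r)"]
      by (simp add: eval_nat_numeral)
  qed
  have neq: "T (Suc a) \<noteq> T (Suc b)" if "a < b" "b < N" for a b
  proof (cases "even (b - a)")
    case True
    then obtain r' where "b - a = 2 * r'" by blast
    then have r: "b = a + 2 * Suc r" if "r = r' - 1" for r using \<open>a < b\<close> that by simp
    then obtain r where r: "b = a + 2 * Suc r" by blast
    then have "D a < D b" using step that by simp
    moreover have "(-1::int) ^ a = (-1) ^ b" by (simp add: r power_add)
    ultimately show ?thesis by (auto simp: D_def)
  next
    case False
    then have "even a \<noteq> even b" using \<open>a < b\<close> by simp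
    then have "(-1::int) ^ a = - ((-1) ^ b)" by (cases "even a") auto
    then show ?thesis using bound[of a] bound[of b] that
      by (auto simp: D_def)
  qed
  have "T a \<noteq> T b" if "a \<in> {1..N}" "b \<in> {1..N}" "a < b" for a b
    using that neq[of "a - 1" "b - 1"] by auto
  then show "inj_on T {1..N}" by (rule linorder_inj_onI')
qed

text \<open>Translates a sign rule that counts supported predecessors into a factor
  \<open>(-1) ^ l\<close> at position \<open>l\<close> of the list of nonzero entries.\<close>

lemma rank_nth_filter_upt:
  assumes "l < length (filter Q [0..<n])"
  shows "card {j'. j' < filter Q [0..<n] ! l \<and> Q j'} = l"
  using assms
proof (induction n)
  case (Suc n)
  have "length (filter Q [0..<n]) = card {j'. j' < n \<and> Q j'}"
    by (simp add: length_filter_conv_card cong: conj_cong)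
  with Suc show ?case
    by (auto simp: nth_append less_Suc_eq split: if_splits)
qed simp

text \<open>An abstract line, so that rows and columns are both instances: \<open>Q\<close> is the
  support, \<open>w\<close> the absolute values, \<open>s\<close> tells which entries are positive,
  and \<open>f\<close> whether the first nonzero one is. Every partial sum is bounded by an entry,
  hence small, and the integer statements carry over to residues.\<close>

lemma alternating_line:
  fixes w x :: "nat \<Rightarrow> int"
  assumes v: "1 < v"
    and w: "\<And>j. j < n \<Longrightarrow> Q j \<Longrightarrow> 0 < w j \<and> small v (w j)"
    and mono: "\<And>i j. i < j \<Longrightarrow> j < n \<Longrightarrow> Q i \<Longrightarrow> Q j \<Longrightarrow> w i < w j"
    and s: "\<And>j. j < n \<Longrightarrow> Q j \<Longrightarrow> s j \<longleftrightarrow> (even (card {j'. j' < j \<and> Q j'}) \<longleftrightarrow> f)"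
    and x: "\<And>j. x j = (if Q j then if s j then w j else - w j else 0)"
  defines "L \<equiv> filter (\<lambda>y. y \<noteq> \<zero>\<^bsub>Zmod v\<^esub>) (map (\<lambda>j. residue v (x j)) [0..<n])"
  shows "length L = card {j. j < n \<and> Q j}"
    and "simple_seq v L"
    and "\<exists>j<n. Q j \<Longrightarrow> (\<Oplus>\<^bsub>Zmod v\<^esub>j\<in>{..<n}. residue v (x j)) \<noteq> \<zero>\<^bsub>Zmod v\<^esub>"
proof -
  define js where "js = filter Q [0..<n]"
  define N where "N = length js"
  define W where "W l = w (js ! l)" for l
  define c :: int where "c = (if f then 1 else -1)"
  define T where "T t = (\<Sum>l<t. (-1) ^ l * W l)" for t
  have "residue v (x j) \<noteq> 0 \<longleftrightarrow> Q j" if "j < n" for j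
    using w[OF that] residue_eq_0_iff[OF v, of "x j"] small_le[of v "w j" "x j"]
    by (auto simp: x)
  then have "filter (\<lambda>j. residue v (x j) \<noteq> 0) [0..<n] = js"
    unfolding js_def by (intro filter_cong) auto
  then have L: "L = map (\<lambda>j. residue v (x j)) js"
    using v by (simp add: L_def filter_map o_def)
  then show "length L = card {j. j < n \<and> Q j}"
    by (simp add: js_def length_filter_conv_card cong: conj_cong)
  have js: "js ! l < n" "Q (js ! l)" if "l < N" for l
    using that nth_mem[of l js] by (auto simp: N_def js_def)
  have W: "0 < W l" "small v (W l)" if "l < N" for l
    using w[OF js[OF that]] by (auto simp: W_def)
  have "sorted_wrt (<) js" by (simp add: js_def sorted_wrt_filter)
  then have Wmono: "W l < W (Suc l)" if "Suc l < N" for l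
    using that mono[of "js ! l" "js ! Suc l"] js[of l] js[of "Suc l"]
    by (simp add: W_def N_def sorted_wrt_nth_less)
  have xjs: "x (js ! l) = c * ((-1) ^ l * W l)" if "l < N" for l
    using s[OF js[OF that]] rank_nth_filter_upt[of l Q n] that js[OF that]
    by (auto simp: x W_def js_def N_def c_def)
  have alt: "\<And>t. t < N \<Longrightarrow> 0 < (-1) ^ t * T (Suc t) \<and> (-1) ^ t * T (Suc t) \<le> W t"
    "inj_on T {1..N}"
    using alternating_partial_sums[of N W, folded T_def] W(1) Wmono by blast+
  have psum: "partial_sum v L t = residue v (c * T t)" if "t \<le> N" for t
  proof -
    interpret cring "Zmod v" by (rule cring_Zmod[OF v])
    have "partial_sum v L t = (\<Oplus>\<^bsub>Zmod v\<^esub>l\<in>{..<t}. residue v (c * ((-1) ^ l * W l)))"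
      unfolding partial_sum_def
      by (rule finsum_cong') (use that in \<open>auto simp: L N_def xjs residue_in_carrier v\<close>)
    then show ?thesis by (simp add: finsum_residue v T_def sum_distrib_left)
  qed
  \<comment> \<open>The sum of length \<open>t\<close> is bounded by its last term, which has index
    \<open>t - 1\<close>.\<close>
  have T: "small v (c * T t) \<and> c * T t \<noteq> 0" if "t \<in> {1..N}" for t
  proof -
    have t: "t - 1 < N" "Suc (t - 1) = t" using that by auto
    have "\<bar>c * T t\<bar> = \<bar>(-1) ^ (t - 1) * T t\<bar>" by (simp add: c_def abs_mult)
    moreover have "0 < (-1) ^ (t - 1) * T t \<and> (-1) ^ (t - 1) * T t \<le> W (t - 1)"
      using alt(1)[OF t(1)] t(2) by simp
    ultimately have "0 < \<bar>c * T t\<bar> \<and> \<bar>c * T t\<bar> \<le> W (t - 1)" by linarith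
    then show ?thesis using small_le[OF W(2)[OF t(1)], of "c * T t"] by auto
  qed
  show "simple_seq v L"
    unfolding simple_seq_def
  proof
    have len: "length L = N" by (simp add: L N_def)
    show "inj_on (partial_sum v L) {1..length L}"
    proof (rule inj_onI)
      fix a b assume ab: "a \<in> {1..length L}" "b \<in> {1..length L}"
        and eq: "partial_sum v L a = partial_sum v L b"
      have "residue v (c * T a) = residue v (c * T b)"
        using eq ab psum[of a] psum[of b] by (simp add: len)
      moreover have "small v (c * T a)" "small v (c * T b)"
        using T[of a] T[of b] ab by (simp_all add: len)
      ultimately have "c * T a = c * T b" using residue_inj by blast
      then have "T a = T b" by (simp add: c_def split: if_splits)
      then show "a = b" using inj_onD[OF alt(2)] ab by (simp add: len)
    qed
    show "\<forall>t\<in>{1..<length L}. partial_sum v L t \<noteq> \<zero>\<^bsub>Zmod v\<^esub>"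
    proof
      fix t assume "t \<in> {1..<length L}"
      then have "t \<le> N" "t \<in> {1..N}" by (auto simp: len)
      then show "partial_sum v L t \<noteq> \<zero>\<^bsub>Zmod v\<^esub>"
        using psum[of t] T[of t] residue_eq_0_iff[OF v, of "c * T t"] v by simp
    qed
  qed
  assume "\<exists>j<n. Q j"
  then have "N \<in> {1..N}" by (auto simp: N_def js_def filter_empty_conv Suc_le_eq)
  \<comment> \<open>The definition of \<open>simple_seq\<close> allows the total to vanish, so it is
    treated separately: zeros contribute nothing, and the sum of the line is the last partial
    sum.\<close>
  have "(\<Sum>j<n. x j) = (\<Sum>j\<in>set js. x j)"
    by (rule sum.mono_neutral_right) (auto simp: js_def x)
  also have "\<dots> = (\<Sum>l<N. x (js ! l))"
    using sum.distinct_set_conv_list[of js x] sum_list_sum_nth[of "map x js"]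
    by (simp add: js_def N_def atLeast0LessThan)
  also have "\<dots> = c * T N" by (simp add: xjs T_def sum_distrib_left)
  finally show "(\<Oplus>\<^bsub>Zmod v\<^esub>j\<in>{..<n}. residue v (x j)) \<noteq> \<zero>\<^bsub>Zmod v\<^esub>"
    using T[OF \<open>N \<in> {1..N}\<close>] residue_eq_0_iff[OF v, of "c * T N"] v by (simp add: finsum_residue)
qed

section \<open>From a signed support to a matrix\<close>

lemma ex_strict_mono_bij_betw:
  fixes A :: "'a :: linorder set" and S :: "'b :: linorder set"
  assumes "finite A" "finite S" "card A = card S"
  shows "\<exists>\<phi>. bij_betw \<phi> A S \<and> strict_mono_on A \<phi>"
  using assms
proof (induction "card A" arbitrary: A S)
  case 0
  then show ?case by (auto simp: bij_betw_def strict_mono_on_def)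
next
  case (Suc N)
  then have ne: "A \<noteq> {}" "S \<noteq> {}" by auto
  \<comment> \<open>The two maxima are matched with each other, and the rest by induction.\<close>
  let ?a = "Max A" and ?s = "Max S"
  have mem: "?a \<in> A" "?s \<in> S" using ne Suc.prems by auto
  have "\<exists>\<phi>. bij_betw \<phi> (A - {?a}) (S - {?s}) \<and> strict_mono_on (A - {?a}) \<phi>"
    using Suc mem by (intro Suc.hyps(1)) auto
  then obtain \<phi> where \<phi>: "bij_betw \<phi> (A - {?a}) (S - {?s})" "strict_mono_on (A - {?a}) \<phi>"
    by blast
  let ?\<phi> = "\<phi>(?a := ?s)"
  have "bij_betw ?\<phi> (A - {?a}) (S - {?s})"
    using \<phi>(1) by (subst bij_betw_cong[where g = \<phi>]) auto
  then have "bij_betw ?\<phi> A S"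
    using notIn_Un_bij_betw3[of ?a "A - {?a}" ?\<phi> "S - {?s}"] mem by (simp add: insert_absorb)
  moreover have "strict_mono_on A ?\<phi>"
  proof (rule strict_mono_onI)
    fix x y assume xy: "x \<in> A" "y \<in> A" "x < y"
    then have "x \<noteq> ?a" using leD[OF Max_ge[OF Suc.prems(1) xy(2)]] by auto
    then have "\<phi> x \<in> S - {?s}" using \<phi>(1) xy by (auto simp: bij_betw_def)
    then have "\<phi> x < ?s" using Suc.prems(2) by (simp add: less_le)
    then show "?\<phi> x < ?\<phi> y"
      using \<open>x \<noteq> ?a\<close> xy \<phi>(2) by (auto simp: strict_mono_on_def)
  qed
  ultimately show ?case by blast
qed


text \<open>Leaves only a pattern \<open>P\<close> and signs \<open>s\<close> to be found.
  \<open>f i\<close> and \<open>g j\<close> say whether row \<open>i\<close> and column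
  \<open>j\<close> begin with a positive entry; both alternation rules must hold for the same
  \<open>s\<close>.\<close>

lemma NGHA_of_alternating_support:
  fixes P s :: "nat \<Rightarrow> nat \<Rightarrow> bool"
  assumes v: "1 < v" and S: "finite S" "S \<subseteq> Zmod_half v" "card S = (\<Sum>i<m. h ! i)"
    and len: "length h = m" "length k = n"
    and row: "\<And>i. i < m \<Longrightarrow> card {j. j < n \<and> P i j} = h ! i \<and> 0 < h ! i"
    and col: "\<And>j. j < n \<Longrightarrow> card {i. i < m \<and> P i j} = k ! j \<and> 0 < k ! j"
    and s_row: "\<And>i j. i < m \<Longrightarrow> j < n \<Longrightarrow> P i j \<Longrightarrow>
      s i j \<longleftrightarrow> (even (card {j'. j' < j \<and> P i j'}) \<longleftrightarrow> f i)"
    and s_col: "\<And>i j. i < m \<Longrightarrow> j < n \<Longrightarrow> P i j \<Longrightarrow>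
      s i j \<longleftrightarrow> (even (card {i'. i' < i \<and> P i' j}) \<longleftrightarrow> g j)"
  shows "\<exists>H \<rho> \<gamma>. is_NGHA v S m n h k H \<rho> \<gamma> \<and> nonzero_sum v m n H \<and>
           simple_orderings v m n \<rho> \<gamma>"
proof -
  define C where "C = {(i, j). i < m \<and> j < n \<and> P i j}"
  \<comment> \<open>The position of a cell in reading order; for \<open>j < n\<close> it is
    injective and increases along rows and down columns.\<close>
  define enc where "enc = (\<lambda>(i, j). i * n + j)"
  have C: "C = (SIGMA i:{..<m}. {j. j < n \<and> P i j})" by (auto simp: C_def)
  have "finite C" unfolding C by (intro finite_SigmaI) auto
  have cardC: "card C = card S"
    unfolding C S(3) by (subst card_SigmaI) (auto simp: row)
  have enc_mono: "enc (i, j) < enc (i', j')" if "i < i'" "j < n" for i j i' j'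
  proof -
    have "i * n + j < Suc i * n" using that by simp
    also have "\<dots> \<le> i' * n + j'" using mult_le_mono1[of "Suc i" i' n] that by linarith
    finally show ?thesis by (simp add: enc_def)
  qed
  have "inj_on enc C"
  proof (rule inj_onI, clarsimp simp: C_def)
    fix i j i' j' assume "j < n" "j' < n" "enc (i, j) = enc (i', j')"
    then show "i = i' \<and> j = j'"
      using enc_mono[of i i' j j'] enc_mono[of i' i j' j]
      by (cases i i' rule: linorder_cases) (auto simp: enc_def)
  qed
  then have bij_enc: "bij_betw enc C (enc ` C)" by (rule inj_on_imp_bij_betw)
  then obtain \<phi> where \<phi>: "bij_betw \<phi> (enc ` C) S" "strict_mono_on (enc ` C) \<phi>"
    using ex_strict_mono_bij_betw[of "enc ` C" S] \<open>finite C\<close> S(1) cardC bij_betw_same_card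
    by (metis finite_imageI)
  define w where "w i j = \<phi> (enc (i, j))" for i j
  have bij_w: "bij_betw (\<lambda>(i, j). w i j) C S"
    using bij_betw_trans[OF bij_enc \<phi>(1)]
    by (rule bij_betw_cong[THEN iffD1, rotated]) (auto simp: w_def)
  have mono: "w i j < w i' j'"
    if "(i, j) \<in> C" "(i', j') \<in> C" "enc (i, j) < enc (i', j')" for i j i' j'
    using \<phi>(2) that by (auto simp: w_def strict_mono_on_def)
  have w: "0 < w i j \<and> small v (w i j)" if "i < m" "j < n" "P i j" for i j
  proof -
    have "w i j \<in> S" using bij_w that by (force simp: bij_betw_def C_def)
    then show ?thesis using S(2) Zmod_half_iff by blast
  qed
  define x where "x i j = (if P i j then if s i j then w i j else - w i j else 0)" for i j
  define H where "H = mat m n (\<lambda>(i, j). residue v (x i j))"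
  have H: "H $$ (i, j) = residue v (x i j)" if "i < m" "j < n" for i j
    using that by (simp add: H_def)
  have H_0: "H $$ (i, j) \<noteq> 0 \<longleftrightarrow> P i j" if "i < m" "j < n" for i j
    using w[OF that] residue_eq_0_iff[OF v, of "x i j"] small_le[of v "w i j" "x i j"]
    by (auto simp: H that x_def)
  have row_entries: "row_entries v H i =
      filter (\<lambda>y. y \<noteq> \<zero>\<^bsub>Zmod v\<^esub>) (map (\<lambda>j. residue v (x i j)) [0..<n])" if "i < m" for i
  proof -
    have "list_of_vec (row H i) = map (\<lambda>j. residue v (x i j)) [0..<n]"
      by (rule nth_equalityI) (use that in \<open>auto simp: H_def list_of_vec_index\<close>)
    then show ?thesis by (simp add: row_entries_def)
  qed
  have col_entries: "col_entries v H j =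
      filter (\<lambda>y. y \<noteq> \<zero>\<^bsub>Zmod v\<^esub>) (map (\<lambda>i. residue v (x i j)) [0..<m])" if "j < n" for j
  proof -
    have "list_of_vec (col H j) = map (\<lambda>i. residue v (x i j)) [0..<m]"
      by (rule nth_equalityI) (use that in \<open>auto simp: H_def list_of_vec_index\<close>)
    then show ?thesis by (simp add: col_entries_def)
  qed
  have row_mono: "w i j < w i j'" if "i < m" "j < j'" "j' < n" "P i j" "P i j'" for i j j'
    using that by (intro mono) (auto simp: C_def enc_def)
  have col_mono: "w i j < w i' j" if "j < n" "i < i'" "i' < m" "P i j" "P i' j" for i i' j
    using that by (intro mono enc_mono) (auto simp: C_def)
  have rows: "length (row_entries v H i) = h ! i" "simple_seq v (row_entries v H i)"
    "(\<Oplus>\<^bsub>Zmod v\<^esub>j\<in>{..<n}. residue v (x i j)) \<noteq> \<zero>\<^bsub>Zmod v\<^esub>" if "i < m" for i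
  proof -
    note line = alternating_line[where n = n and Q = "P i" and w = "w i" and s = "s i"
        and x = "x i" and f = "f i", OF v w[OF that] row_mono[OF that] s_row[OF that] x_def]
    show "length (row_entries v H i) = h ! i"
      using line(1) row[OF that] by (simp add: row_entries[OF that])
    show "simple_seq v (row_entries v H i)"
      using line(2) by (simp add: row_entries[OF that])
    have "{j. j < n \<and> P i j} \<noteq> {}" using row[OF that] by (metis card.empty less_irrefl)
    then show "(\<Oplus>\<^bsub>Zmod v\<^esub>j\<in>{..<n}. residue v (x i j)) \<noteq> \<zero>\<^bsub>Zmod v\<^esub>"
      by (intro line(3)) auto
  qed
  have cols: "length (col_entries v H j) = k ! j" "simple_seq v (col_entries v H j)"
    "(\<Oplus>\<^bsub>Zmod v\<^esub>i\<in>{..<m}. residue v (x i j)) \<noteq> \<zero>\<^bsub>Zmod v\<^esub>" if "j < n" for j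
  proof -
    note line = alternating_line[where n = m and Q = "\<lambda>i. P i j" and w = "\<lambda>i. w i j"
        and s = "\<lambda>i. s i j" and x = "\<lambda>i. x i j" and f = "g j",
        OF v w[OF _ that] col_mono[OF that] s_col[OF _ that] x_def]
    show "length (col_entries v H j) = k ! j"
      using line(1) col[OF that] by (simp add: col_entries[OF that])
    show "simple_seq v (col_entries v H j)"
      using line(2) by (simp add: col_entries[OF that])
    have "{i. i < m \<and> P i j} \<noteq> {}" using col[OF that] by (metis card.empty less_irrefl)
    then show "(\<Oplus>\<^bsub>Zmod v\<^esub>i\<in>{..<m}. residue v (x i j)) \<noteq> \<zero>\<^bsub>Zmod v\<^esub>"
      by (intro line(3)) auto
  qed
  interpret cring "Zmod v" by (rule cring_Zmod[OF v])
  have "(\<Oplus>\<^bsub>Zmod v\<^esub>j\<in>{..<n}. H $$ (i, j)) = (\<Oplus>\<^bsub>Zmod v\<^esub>j\<in>{..<n}. residue v (x i j))"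
    if "i < m" for i
    by (rule finsum_cong') (use that v in \<open>auto simp: H residue_in_carrier\<close>)
  moreover have
    "(\<Oplus>\<^bsub>Zmod v\<^esub>i\<in>{..<m}. H $$ (i, j)) = (\<Oplus>\<^bsub>Zmod v\<^esub>i\<in>{..<m}. residue v (x i j))"
    if "j < n" for j
    by (rule finsum_cong') (use that v in \<open>auto simp: H residue_in_carrier\<close>)
  ultimately have "nonzero_sum v m n H"
    using rows(3) cols(3) by (simp add: nonzero_sum_def)
  moreover have "is_GHA v S m n h k H"
  proof -
    have "s \<oplus>\<^bsub>Zmod v\<^esub> s \<noteq> \<zero>\<^bsub>Zmod v\<^esub>" if "s \<in> S" for s
    proof -
      have s: "0 < s" "small v s" using S(2) that Zmod_half_iff by auto
      then have "residue v s = s" "residue v (s + s) \<noteq> 0"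
        using v by (auto simp: residue_def small_def split: enat.splits)
      then show ?thesis using residue_add[OF v, of s s] v by simp
    qed
    moreover have "{(i, j). i < m \<and> j < n \<and> H $$ (i, j) \<noteq> \<zero>\<^bsub>Zmod v\<^esub>} = C"
      using H_0 v by (auto simp: C_def)
    moreover have "image_mset (\<lambda>(i, j). Zmod_abs v (H $$ (i, j))) (mset_set C) = mset_set S"
    proof -
      have "Zmod_abs v (H $$ (i, j)) = w i j" if "(i, j) \<in> C" for i j
        using that w[of i j] Zmod_abs_residue[OF v, of "w i j"] by (simp add: C_def H x_def)
      then have "image_mset (\<lambda>(i, j). Zmod_abs v (H $$ (i, j))) (mset_set C) =
          image_mset (\<lambda>(i, j). w i j) (mset_set C)"
        by (intro image_mset_cong) (auto simp: \<open>finite C\<close>)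
      then show ?thesis using bij_w by (simp add: image_mset_mset_set bij_betw_def)
    qed
    ultimately show ?thesis
      using S Zmod_half_subset[of v] len rows(1) cols(1) residue_in_carrier[OF v]
      by (auto simp: is_GHA_def H) (simp_all add: H_def)
  qed
  \<comment> \<open>The natural orderings are rotations by 0.\<close>
  then have "is_NGHA v S m n h k H (row_entries v H) (col_entries v H)"
    by (auto simp: is_NGHA_def natural_ordering_def intro: exI[of _ 0])
  moreover have "simple_orderings v m n (row_entries v H) (col_entries v H)"
    using rows(2) cols(2) by (simp add: simple_orderings_def)
  ultimately show ?thesis by blast
qed

section \<open>Constant weights: Toeplitz patterns\<close>

lemma card_less_Suc_conj:
  "card {j. j < Suc n \<and> Q j} = card {j. j < n \<and> Q j} + (if Q n then 1 else 0)"
proof -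
  have "{j. j < Suc n \<and> Q j} = (if Q n then insert n {j. j < n \<and> Q j} else {j. j < n \<and> Q j})"
    by (auto simp: less_Suc_eq)
  then show ?thesis by simp
qed

text \<open>Up to an additive constant, the number of integers below \<open>x\<close> whose residue modulo \<open>g\<close> is
  less than \<open>e\<close>.\<close>

definition band_rank :: "int \<Rightarrow> int \<Rightarrow> int \<Rightarrow> int" where
  "band_rank g e x = e * (x div g) + min (x mod g) e"

text \<open>Inside a period only the \<open>min\<close> term can change. At the end of a period the
  first term gains \<open>e\<close> while the other drops from \<open>min (g - 1) e\<close> to 0: a
  net gain of 1 if \<open>e = g\<close>, and of 0 otherwise.\<close>

lemma band_rank_add_1:
  assumes "0 < g" "0 \<le> e" "e \<le> g"
  shows "band_rank g e (x + 1) = band_rank g e x + (if x mod g < e then 1 else 0)"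
proof -
  define q t where "q = x div g" and "t = x mod g"
  have x: "x = g * q + t" "0 \<le> t" "t < g" using assms(1) by (auto simp: q_def t_def)
  show ?thesis
  proof (cases "t + 1 < g")
    case True
    then have "(x + 1) div g = q" "(x + 1) mod g = t + 1"
      using x by (auto intro!: int_div_pos_eq int_mod_pos_eq)
    then show ?thesis using assms by (auto simp: band_rank_def simp flip: q_def t_def)
  next
    case False
    then have "t = g - 1" using x by simp
    then have "x + 1 = g * (q + 1)" using x by (simp add: algebra_simps)
    then have "(x + 1) div g = q + 1" "(x + 1) mod g = 0" using assms(1) by simp_all
    then show ?thesis using assms \<open>t = g - 1\<close>
      by (auto simp: band_rank_def algebra_simps simp flip: q_def t_def)
  qed
qed

lemma band_rank_add_mult:
  "0 < g \<Longrightarrow> band_rank g e (x + g * q) = band_rank g e x + e * q"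
  by (simp add: band_rank_def algebra_simps)

text \<open>By \<open>band_rank_add_1\<close> the count telescopes.\<close>

lemma card_band_row:
  assumes "0 < g" "0 \<le> e" "e \<le> g"
  shows "int (card {j'. j' < j \<and> (int j' - c) mod g < e}) =
    band_rank g e (int j - c) - band_rank g e (- c)"
proof (induction j)
  case (Suc j)
  then show ?case using band_rank_add_1[OF assms, of "int j - c"]
    by (auto simp: card_less_Suc_conj algebra_simps)
qed simp

text \<open>Going down a column the diagonal index falls from \<open>c\<close> to
  \<open>c + 1 - i\<close>; the telescoping therefore ends at \<open>c + 1\<close>, not at
  \<open>c\<close>.\<close>

lemma card_band_col:
  assumes "0 < g" "0 \<le> e" "e \<le> g"
  shows "int (card {i'. i' < i \<and> (c - int i') mod g < e}) =
    band_rank g e (c + 1) - band_rank g e (c + 1 - int i)"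
proof (induction i)
  case (Suc i)
  then show ?case using band_rank_add_1[OF assms, of "c - int i"]
    by (auto simp: card_less_Suc_conj algebra_simps)
qed simp

lemma NGHA_constant:
  assumes v: "1 < v" and S: "finite S" "S \<subseteq> Zmod_half v" "card S = m * c"
    and mc: "m * c = n * d" and pos: "0 < m" "0 < n" "0 < c" "c \<le> n"
  shows "\<exists>H \<rho> \<gamma>. is_NGHA v S m n (replicate m c) (replicate n d) H \<rho> \<gamma> \<and> nonzero_sum v m n H \<and>
           simple_orderings v m n \<rho> \<gamma>"
proof -
  obtain g m' n' where g: "m = g * m'" "n = g * n'" "coprime m' n'" "0 < g"
    using gcd_coprime_exists[of m n] pos(1)
    by (metis gcd_pos_nat mult.commute not_gr_zero gcd_eq_0_iff)
  \<comment> \<open>Coprimality makes \<open>e = c / n'\<close> an integer. As \<open>g\<close>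
    divides \<open>m\<close> and \<open>n\<close>, a row meets every class of diagonals modulo
    \<open>g\<close> exactly \<open>n'\<close> times and a column \<open>m'\<close> times, which
    yields the weights \<open>n' * e\<close> and \<open>m' * e\<close>.\<close>
  have "m' * c = n' * d" using mc g by simp
  then have "n' dvd c" using g(3) by (metis coprime_commute coprime_dvd_mult_right_iff dvd_triv_left)
  then obtain e where c: "c = n' * e" by blast
  have d: "d = m' * e" using \<open>m' * c = n' * d\<close> c pos by (simp add: mult.left_commute)
  have "e \<le> g" using pos c g by (simp add: mult.commute)
  have g': "0 < int g" "0 \<le> int e" "int e \<le> int g" using g \<open>e \<le> g\<close> by auto
  note row = card_band_row[OF g'] and col = card_band_col[OF g']
  define P where "P i j \<longleftrightarrow> (int j - int i) mod int g < int e" for i j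
  show ?thesis
  proof (rule NGHA_of_alternating_support[where P = P
        and s = "\<lambda>i j. even (band_rank g e (int j - int i))"
        and f = "\<lambda>i. even (band_rank g e (- int i))"
        and g = "\<lambda>j. odd (band_rank g e (int j + 1))"])
    fix i assume "i < m"
    have "int (card {j. j < n \<and> P i j}) = int c"
      using row[of n "int i"] band_rank_add_mult[OF g'(1), of e "- int i" "int n'"]
      by (simp add: P_def g(2) c algebra_simps)
    then show "card {j. j < n \<and> P i j} = replicate m c ! i \<and> 0 < replicate m c ! i"
      using \<open>i < m\<close> pos by simp
  next
    fix j assume "j < n"
    have "int (card {i. i < m \<and> P i j}) = int d"
      using col[of m "int j"] band_rank_add_mult[OF g'(1), of e "int j + 1 - int m" "int m'"]
      by (simp add: P_def g(1) d algebra_simps)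
    moreover have "0 < d" using mc pos by (metis mult_eq_0_iff not_gr_zero)
    ultimately show "card {i. i < m \<and> P i j} = replicate n d ! j \<and> 0 < replicate n d ! j"
      using \<open>j < n\<close> by simp
  next
    fix i j
    have "even (int (card {j'. j' < j \<and> P i j'})) \<longleftrightarrow>
        (even (band_rank g e (int j - int i)) \<longleftrightarrow> even (band_rank g e (- int i)))"
      using row[of j "int i"] by (simp add: P_def)
    then show "even (band_rank g e (int j - int i)) \<longleftrightarrow>
        (even (card {j'. j' < j \<and> P i j'}) \<longleftrightarrow> even (band_rank g e (- int i)))"
      by auto
    assume "P i j"
    \<comment> \<open>The column count involves the rank just after the diagonal of the cell, one
      more than the rank defining its sign; hence \<open>odd\<close> in the choice for
      columns.\<close>
    then have "band_rank g e (int j + 1 - int i) = band_rank g e (int j - int i) + 1"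
      using band_rank_add_1[OF g', of "int j - int i"] by (simp add: P_def algebra_simps)
    then have "even (int (card {i'. i' < i \<and> P i' j})) \<longleftrightarrow>
        (even (band_rank g e (int j - int i)) \<longleftrightarrow> odd (band_rank g e (int j + 1)))"
      using col[of i "int j"] by (simp add: P_def) argo
    then show "even (band_rank g e (int j - int i)) \<longleftrightarrow>
        (even (card {i'. i' < i \<and> P i' j}) \<longleftrightarrow> odd (band_rank g e (int j + 1)))"
      by auto
  qed (use v S in auto)
qed

section \<open>The Gale-Ryser theorem\<close>

lemma ex_top_subset:
  fixes a :: "'a \<Rightarrow> 'b :: linorder"
  assumes "finite I" "k \<le> card I"
  shows "\<exists>R\<subseteq>I. card R = k \<and> (\<forall>i\<in>R. \<forall>i'\<in>I - R. a i' \<le> a i)"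
  using assms(2)
proof (induction k)
  case 0
  then show ?case by (intro exI[of _ "{}"]) auto
next
  case (Suc k)
  then obtain R where R: "R \<subseteq> I" "card R = k" "\<forall>i\<in>R. \<forall>i'\<in>I - R. a i' \<le> a i" by auto
  have "finite R" using R(1) assms(1) finite_subset by blast
  have "I - R \<noteq> {}" using R Suc.prems by (metis Diff_eq_empty_iff Suc_n_not_le_n subset_antisym)
  then have "Max (a ` (I - R)) \<in> a ` (I - R)" using assms(1) by (intro Max_in) auto
  \<comment> \<open>A largest remaining element may be added, since \<open>R\<close> already
    dominates all of \<open>I - R\<close>.\<close>
  then obtain x where "x \<in> I - R" "a x = Max (a ` (I - R))" by auto
  then have x: "x \<in> I - R" "\<forall>i'\<in>I - R. a i' \<le> a x" using assms(1) by auto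
  show ?case
    using R x \<open>finite R\<close> by (intro exI[of _ "insert x R"]) auto
qed

text \<open>Induction on the columns: column \<open>p\<close> is placed in the \<open>b p\<close>
  rows of largest demand, whose demands then drop by 1. Stating domination for all sets
  \<open>U\<close> of columns, and not for prefixes of a sorted sequence, lets the columns be
  removed in any order.\<close>

theorem gale_ryser:
  fixes a :: "'a \<Rightarrow> nat" and b :: "'b \<Rightarrow> nat"
  assumes "finite J" "finite I" "sum a I = sum b J"
    and "\<And>U. U \<subseteq> J \<Longrightarrow> sum b U \<le> (\<Sum>i\<in>I. min (a i) (card U))"
  shows "\<exists>B. (\<forall>i\<in>I. card {j \<in> J. B i j} = a i) \<and> (\<forall>j\<in>J. card {i \<in> I. B i j} = b j)"
  using assms
proof (induction J arbitrary: a)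
  case empty
  then show ?case by simp
next
  case (insert p J)
  \<comment> \<open>The condition for \<open>{p}\<close> says that at least \<open>b p\<close> rows
    have nonzero demand.\<close>
  have b_le: "b p \<le> (\<Sum>i\<in>I. min (a i) 1)" using insert.prems(3)[of "{p}"] by simp
  also have min_1: "(\<Sum>i\<in>I. min (a i) 1) = card {i \<in> I. a i \<noteq> 0}"
    unfolding card_eq_sum sum.inter_filter[OF insert.prems(1)] by (rule sum.cong) auto
  also have "\<dots> \<le> card I" using insert.prems(1) by (intro card_mono) auto
  finally obtain R where R: "R \<subseteq> I" "card R = b p" "\<forall>i\<in>R. \<forall>i'\<in>I - R. a i' \<le> a i"
    using ex_top_subset[OF insert.prems(1), of "b p" a] by blast
  have "finite R" using R(1) insert.prems(1) finite_subset by blast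
  \<comment> \<open>A chosen row of demand 0 would force demand 0 on all unchosen rows, leaving
    fewer than \<open>b p\<close> nonzero ones.\<close>
  have a_pos: "0 < a i" if "i \<in> R" for i
  proof (rule ccontr)
    assume "\<not> 0 < a i"
    moreover from this have "a i' = 0" if "i' \<in> I - R" for i'
      using R(3) \<open>i \<in> R\<close> that by fastforce
    ultimately have "{i \<in> I. a i \<noteq> 0} \<subseteq> R - {i}" by force
    then have "card {i \<in> I. a i \<noteq> 0} \<le> card (R - {i})" using \<open>finite R\<close> by (intro card_mono) auto
    moreover have "card (R - {i}) < card R" using \<open>finite R\<close> that by (rule card_Diff1_less)
    ultimately show False using b_le min_1 R(2) by simp
  qed
  define \<chi> where "\<chi> i = (if i \<in> R then 1 else 0 :: nat)" for i
  have \<chi>: "sum \<chi> I = b p"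
    using R(1,2) insert.prems(1) by (simp add: \<chi>_def sum.If_cases Int_absorb1)
  define a' where "a' i = a i - \<chi> i" for i
  have a': "a i = a' i + \<chi> i" for i using a_pos by (auto simp: a'_def \<chi>_def Suc_le_eq)
  have "sum a I = sum a' I + b p" by (simp add: a' sum.distrib \<chi>)
  then have "sum a' I = sum b J" using insert by simp
  \<comment> \<open>If all chosen demands exceed \<open>card U\<close>, lowering them does not
    affect the truncation at \<open>card U\<close>. Otherwise all unchosen demands are at most
    \<open>card U\<close>, and the condition for \<open>insert p U\<close> loses exactly
    \<open>b p\<close> on both sides.\<close>
  moreover have "sum b U \<le> (\<Sum>i\<in>I. min (a' i) (card U))" if "U \<subseteq> J" for U
  proof (cases "\<exists>i\<in>R. a i \<le> card U")
    case False
    then have "min (a' i) (card U) = min (a i) (card U)" for i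
      by (auto simp: a'_def \<chi>_def)
    then show ?thesis using insert.prems(3)[of U] that by auto
  next
    case True
    then have *: "a i \<le> card U" if "i \<in> I - R" for i using R(3) that le_trans by blast
    have "min (a i) (card U + 1) = min (a' i) (card U) + \<chi> i" if "i \<in> I" for i
      using *[of i] a_pos[of i] that by (auto simp: a'_def \<chi>_def)
    then have eq: "(\<Sum>i\<in>I. min (a i) (card U + 1)) = (\<Sum>i\<in>I. min (a' i) (card U)) + b p"
      by (simp add: sum.distrib \<chi>)
    have U: "finite U" "p \<notin> U" using that insert finite_subset by blast+
    then have "sum b U + b p \<le> (\<Sum>i\<in>I. min (a i) (card U + 1))"
      using insert.prems(3)[of "insert p U"] that by (auto simp: add.commute)
    then show ?thesis using eq by simp
  qed
  ultimately obtain B where B: "\<forall>i\<in>I. card {j \<in> J. B i j} = a' i"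
    "\<forall>j\<in>J. card {i \<in> I. B i j} = b j"
    using insert.IH[of a'] insert.prems(1) by blast
  define B' where "B' i j \<longleftrightarrow> (if j = p then i \<in> R else B i j)" for i j
  have "card {j \<in> insert p J. B' i j} = a i" if "i \<in> I" for i
  proof -
    have "{j \<in> insert p J. B' i j} =
        (if i \<in> R then insert p {j \<in> J. B i j} else {j \<in> J. B i j})"
      using insert.hyps(2) by (auto simp: B'_def)
    then show ?thesis using B(1) that insert.hyps by (simp add: a'[of i] \<chi>_def)
  qed
  moreover have "card {i \<in> I. B' i j} = b j" if "j \<in> insert p J" for j
  proof (cases "j = p")
    case True
    then have "{i \<in> I. B' i j} = R" using R(1) by (auto simp: B'_def)
    then show ?thesis using R(2) True by simp
  qed (use B(2) that in \<open>simp add: B'_def\<close>)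
  ultimately show ?case by blast
qed

section \<open>Doubled weights: blowing up a pattern to 2 x 2 blocks\<close>

lemma sum_le_sum_prefix:
  fixes c :: "nat \<Rightarrow> 'a :: ordered_comm_monoid_add"
  assumes "\<And>i j. i \<le> j \<Longrightarrow> j < N \<Longrightarrow> c j \<le> c i" "V \<subseteq> {..<N}"
  shows "sum c V \<le> sum c {..<card V}"
  using assms(2)
proof (induction "card V" arbitrary: V)
  case 0
  then show ?case using finite_subset[of V "{..<N}"] by auto
next
  case (Suc r)
  have "finite V" using Suc.prems finite_subset by blast
  then have V: "Max V \<in> V" "V \<subseteq> {..Max V}" using Suc.hyps(2) by (auto intro!: Max_in)
  \<comment> \<open>The largest index of \<open>V\<close> is at least \<open>r\<close>, the last
    index of the prefix, so its value is at most \<open>c r\<close>.\<close>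
  have "card V \<le> Suc (Max V)" using card_mono[OF _ V(2)] by simp
  then have "r \<le> Max V" using Suc.hyps(2) by simp
  moreover have "Max V < N" using V(1) Suc.prems by blast
  ultimately have "c (Max V) \<le> c r" by (rule assms(1))
  moreover have r: "card (V - {Max V}) = r" using V(1) Suc.hyps(2) by simp
  then have "sum c (V - {Max V}) \<le> sum c {..<r}"
    using Suc.hyps(1)[of "V - {Max V}"] Suc.prems by auto
  ultimately show ?case
    using sum.remove[OF \<open>finite V\<close> V(1), of c] Suc.hyps(2)[symmetric]
    by (simp add: add_mono add.commute)
qed

text \<open>Passes from prefixes of the sorted weights to the arbitrary column sets of
  \<open>gale_ryser\<close>: the sorting permutation maps \<open>U\<close> to a set of the same
  size.\<close>

lemma sum_le_nonincreasing_reordering: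
  assumes "U \<subseteq> {..<length k}"
  shows "(\<Sum>j\<in>U. k ! j) \<le> (\<Sum>j<card U. nonincreasing_reordering k ! j)"
proof -
  define c where "c j = nonincreasing_reordering k ! j" for j
  have "mset k = mset (nonincreasing_reordering k)" by (simp add: nonincreasing_reordering_def)
  then obtain f where f: "bij_betw f {..<length k} {..<length k}" "\<forall>i<length k. k ! i = c (f i)"
    using permutation_Ex_bij[of k "nonincreasing_reordering k"]
    by (auto simp: c_def nonincreasing_reordering_def)
  have inj: "inj_on f U" using f(1) assms by (meson bij_betw_def inj_on_subset)
  have "(\<Sum>j\<in>U. k ! j) = (\<Sum>j\<in>U. c (f j))" using f(2) assms by (intro sum.cong) auto
  also have "\<dots> = sum c (f ` U)" using inj by (simp add: sum.reindex)
  also have "\<dots> \<le> sum c {..<card (f ` U)}"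
  proof (rule sum_le_sum_prefix)
    show "f ` U \<subseteq> {..<length k}" using f(1) assms by (auto simp: bij_betw_def)
    fix i j assume "i \<le> j" "j < length k"
    then show "c j \<le> c i"
      by (auto simp: c_def nonincreasing_reordering_def rev_nth intro!: sorted_nth_mono)
  qed
  finally show ?thesis using inj by (simp add: c_def card_image)
qed

lemma sum_div_2:
  fixes F :: "nat \<Rightarrow> nat"
  shows "(\<Sum>j<2 * q. F (j div 2)) = 2 * (\<Sum>p<q. F p)"
  by (induction q) simp_all

lemma card_div_2:
  fixes q :: nat
  shows "card {j. j < 2 * q \<and> Q (j div 2)} = 2 * card {p. p < q \<and> Q p}"
  by (induction q) (simp_all add: card_less_Suc_conj)

lemma doubled_pairsE:
  assumes "doubled_pairs ys"
  obtains xs where "length ys = 2 * length xs" "\<forall>x\<in>set xs. 0 < x"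
    "\<And>i. i < length ys \<Longrightarrow> ys ! i = 2 * xs ! (i div 2)"
proof -
  let ?d = "\<lambda>xs. map (\<lambda>x::nat. 2 * x) (concat (map (\<lambda>x. [x, x]) xs))"
  obtain xs where xs: "\<forall>x\<in>set xs. 0 < x" "ys = ?d xs"
    using assms by (auto simp: doubled_pairs_def)
  have len: "length (?d xs) = 2 * length xs" for xs by (induction xs) auto
  have "i < 2 * length xs \<Longrightarrow> ?d xs ! i = 2 * xs ! (i div 2)" for i
  proof (induction xs arbitrary: i)
    case (Cons x xs)
    then show ?case
      by (cases i; cases "i - 1") auto
  qed simp
  then show thesis using that[of xs] xs len by simp
qed

text \<open>Complete pairs before \<open>j\<close> contribute an even number; if \<open>j\<close> is
  odd, its partner \<open>j - 1\<close> is supported as well and adds 1.\<close>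

lemma even_card_div_2:
  fixes j :: nat
  assumes "Q (j div 2)"
  shows "even (card {j'. j' < j \<and> Q (j' div 2)}) \<longleftrightarrow> even j"
proof (cases "even j")
  case True
  then show ?thesis using card_div_2[of "j div 2" Q] by simp
next
  case False
  then obtain q where "j = Suc (2 * q)" by (auto elim: oddE)
  then show ?thesis
    using card_div_2[of q Q] card_less_Suc_conj[of "2 * q" "\<lambda>j. Q (j div 2)"] assms by simp
qed

lemma NGHA_doubled_pairs:
  assumes v: "1 < v" and S: "finite S" "S \<subseteq> Zmod_half v"
    and len: "length h = m" "length k = n"
    and card: "card S = (\<Sum>i<m. h ! i)" "card S = (\<Sum>j<n. k ! j)"
    and pairs: "doubled_pairs h" "doubled_pairs k"
    and dominated: "\<And>u. u \<in> {1..n} \<Longrightarrow>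
      (\<Sum>j<u. nonincreasing_reordering k ! j) \<le> (\<Sum>i<m. min (h ! i) u)"
  shows "\<exists>H \<rho> \<gamma>. is_NGHA v S m n h k H \<rho> \<gamma> \<and> nonzero_sum v m n H \<and>
           simple_orderings v m n \<rho> \<gamma>"
proof -
  obtain a where a: "m = 2 * length a" "\<forall>x\<in>set a. 0 < x"
    "\<And>i. i < m \<Longrightarrow> h ! i = 2 * a ! (i div 2)"
    using doubled_pairsE[OF pairs(1)] len by metis
  obtain b where b: "n = 2 * length b" "\<forall>x\<in>set b. 0 < x"
    "\<And>j. j < n \<Longrightarrow> k ! j = 2 * b ! (j div 2)"
    using doubled_pairsE[OF pairs(2)] len by metis
  define M N where "M = length a" and "N = length b"
  \<comment> \<open>\<open>F\<close> will be the identity, for the total weights, and truncation at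
    \<open>2 * card U\<close>, for domination.\<close>
  have sum_h: "(\<Sum>i<m. F (h ! i)) = 2 * (\<Sum>i<M. F (2 * a ! i))" for F :: "nat \<Rightarrow> nat"
    using sum_div_2[of "\<lambda>i. F (2 * a ! i)" M] by (simp add: a M_def)
  have sum_k: "(\<Sum>j<n. k ! j) = 2 * (\<Sum>j<N. 2 * b ! j)"
    using sum_div_2[of "\<lambda>j. 2 * b ! j" N] by (simp add: b N_def)
  have "\<exists>B. (\<forall>i\<in>{..<M}. card {j \<in> {..<N}. B i j} = a ! i) \<and>
      (\<forall>j\<in>{..<N}. card {i \<in> {..<M}. B i j} = b ! j)"
  proof (rule gale_ryser)
    show "(\<Sum>i<M. a ! i) = (\<Sum>j<N. b ! j)"
      using card sum_h[of "\<lambda>x. x"] sum_k by (simp add: sum_distrib_left[symmetric])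
    fix U assume U: "U \<subseteq> {..<N}"
    then have "finite U" using finite_subset by blast
    show "(\<Sum>j\<in>U. b ! j) \<le> (\<Sum>i<M. min (a ! i) (card U))"
    proof (cases "U = {}")
      case False
      \<comment> \<open>The columns lying over \<open>U\<close>. Doubling both the indices and the
        weights gives a factor 4 on either side of the inequality.\<close>
      let ?U = "{j. j < 2 * N \<and> j div 2 \<in> U}"
      have "{p. p < N \<and> p \<in> U} = U" using U by auto
      then have card_U: "card ?U = 2 * card U" using card_div_2[of N "\<lambda>p. p \<in> U"] by simp
      have "card U \<le> N" using card_mono[OF _ U] by simp
      moreover have "0 < card U" using False \<open>finite U\<close> by (simp add: card_gt_0_iff)
      ultimately have u: "2 * card U \<in> {1..n}" by (simp add: b(1) N_def)
      have "4 * (\<Sum>j\<in>U. b ! j) = 2 * (\<Sum>p<N. if p \<in> U then 2 * b ! p else 0)"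
        using U by (simp add: sum.If_cases Int_absorb1 sum_distrib_left[symmetric])
      also have "\<dots> = (\<Sum>j<2 * N. if j div 2 \<in> U then 2 * b ! (j div 2) else 0)"
        by (rule sum_div_2[symmetric])
      also have "\<dots> = (\<Sum>j\<in>?U. 2 * b ! (j div 2))"
        by (simp add: sum.If_cases lessThan_def Collect_conj_eq)
      also have "\<dots> = (\<Sum>j\<in>?U. k ! j)"
        by (rule sum.cong) (auto simp: b N_def)
      also have "\<dots> \<le> (\<Sum>j<2 * card U. nonincreasing_reordering k ! j)"
        using sum_le_nonincreasing_reordering[of ?U k] len b(1) card_U by (force simp: N_def)
      also have "\<dots> \<le> (\<Sum>i<m. min (h ! i) (2 * card U))" by (rule dominated[OF u])
      also have "\<dots> = 4 * (\<Sum>i<M. min (a ! i) (card U))"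
        using sum_h[of "\<lambda>x. min x (2 * card U)"]
        by (simp add: sum_distrib_left[symmetric] flip: nat_mult_min_right)
      finally show ?thesis by simp
    qed simp
  qed auto
  then obtain B where B: "\<And>i. i < M \<Longrightarrow> card {j. j < N \<and> B i j} = a ! i"
    "\<And>j. j < N \<Longrightarrow> card {i. i < M \<and> B i j} = b ! j" by auto
  \<comment> \<open>Checkerboard signs: the first supported cell of a row has an even column index,
    and that of a column an even row index, whence \<open>even\<close> for both \<open>f\<close> and
    \<open>g\<close>.\<close>
  show ?thesis
  proof (rule NGHA_of_alternating_support[where P = "\<lambda>i j. B (i div 2) (j div 2)"
        and s = "\<lambda>i j. even i \<longleftrightarrow> even j" and f = even and g = even, OF v S card(1) len])
    fix i assume "i < m"
    then have "i div 2 < M" by (auto simp: a(1) M_def)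
    then show "card {j. j < n \<and> B (i div 2) (j div 2)} = h ! i \<and> 0 < h ! i"
      using card_div_2[of N "B (i div 2)"] B(1) a(2) a(3)[OF \<open>i < m\<close>]
      by (simp add: b(1) M_def flip: N_def)
  next
    fix j assume "j < n"
    then have "j div 2 < N" by (auto simp: b(1) N_def)
    then show "card {i. i < m \<and> B (i div 2) (j div 2)} = k ! j \<and> 0 < k ! j"
      using card_div_2[of M "\<lambda>i. B i (j div 2)"] B(2) b(2) b(3)[OF \<open>j < n\<close>]
      by (simp add: a(1) N_def flip: M_def)
  next
    fix i j assume "B (i div 2) (j div 2)"
    then show "(even i \<longleftrightarrow> even j) \<longleftrightarrow>
        (even (card {j'. j' < j \<and> B (i div 2) (j' div 2)}) \<longleftrightarrow> even i)"
      and "(even i \<longleftrightarrow> even j) \<longleftrightarrow>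
        (even (card {i'. i' < i \<and> B (i' div 2) (j div 2)}) \<longleftrightarrow> even j)"
      using even_card_div_2[of "B (i div 2)" j] even_card_div_2[of "\<lambda>i. B i (j div 2)" i]
      by auto
  qed
qed

theorem theorem1p7:
  fixes v :: enat and m n :: nat and h k :: "nat list" and S :: "int set"
  assumes "0 < v" and "0 < m" and "0 < n"
    and "length h = m" and "length k = n"
    and "\<forall>i<m. 1 \<le> h ! i \<and> h ! i \<le> n"
    and "\<forall>j<n. 1 \<le> k ! j \<and> k ! j \<le> m"
    and "S \<subseteq> Zmod_half v"
    and "card S = (\<Sum>i<m. h ! i)" and "card S = (\<Sum>j<n. k ! j)"
    and "(constant_seq h \<and> constant_seq k) \<or>
         (even m \<and> even n \<and> doubled_pairs h \<and> doubled_pairs k \<and>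
          (\<forall>u\<in>{1..n}. (\<Sum>i<m. min (h ! i) u) \<ge>
             (\<Sum>j<u. nonincreasing_reordering k ! j)))"
  shows "\<exists>H \<rho> \<gamma>. is_NGHA v S m n h k H \<rho> \<gamma> \<and> nonzero_sum v m n H \<and>
           simple_orderings v m n \<rho> \<gamma>"
proof -
  \<comment> \<open>\<open>card\<close> is 0 on infinite sets, so a positive total weight makes
    \<open>S\<close> finite and nonempty.\<close>
  have "h ! 0 \<le> (\<Sum>i<m. h ! i)" using assms(2) by (intro member_le_sum) auto
  then have "0 < card S" using assms(2,6,9) by force
  then have S: "finite S" "S \<noteq> {}" by (auto simp: card_gt_0_iff)
  \<comment> \<open>\<open>Zmod_half 1\<close> is empty, so the trivial ring cannot occur.\<close>
  then have v: "1 < v"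
    using assms(8) by (auto simp: Zmod_half_def one_enat_def split: enat.splits)
  show ?thesis
  proof (cases "constant_seq h \<and> constant_seq k")
    case True
    then obtain c d where hk: "h = replicate m c" "k = replicate n d"
      using assms(4,5) by (auto simp: constant_seq_def)
    show ?thesis unfolding hk
      by (rule NGHA_constant) (use assms S(1) v in \<open>auto simp: hk Suc_le_eq\<close>)
  next
    case False
    then show ?thesis
      using assms(11) by (intro NGHA_doubled_pairs[OF v S(1) assms(8,4,5,9,10)]) auto
  qed
qed

end
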